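(* Let $v$ be a positive integer and, for $1\le i\le v$, let $(X_i,\kappa_i)$ and $(Y_i,\lambda_i)$ be digital images. Let $X=\big(\prod_{i=1}^v X_i, NP_v(\kappa_1,\ldots,\kappa_v)\big)$ and $Y=\big(\prod_{i=1}^v Y_i, NP_v(\lambda_1,\ldots,\lambda_v)\big)$. For each $i$ let $f_i,g_i: X_i\to Y_i$ be continuous and let $H_i: X_i\times[0,m_i]_{\mathbb{Z}}\to Y_i$ be a homotopy from $f_i$ to $g_i$. Then there is a homotopy $H$ between the product maps $F=\prod_{i=1}^v f_i: X\to Y$ and $G=\prod_{i=1}^v g_i: X\to Y$. Moreover, if the homotopies $H_i$ are all pointed, then $H$ can be taken to be pointed.
   Context: A digital image $(X,\kappa)$ is a set $X$ (of lattice points in some $\mathbb{Z}^n$) with an adjacency relation $\kappa$, i.e. a symmetric irreflexive binary relation on $X$. A function $f:(X,\kappa)\to(Y,\lambda)$ is $(\kappa,\lambda)$-continuous if for all $\kappa$-adjacent $x,x'\in X$ the points $f(x),f(x')$ are equal or $\lambda$-adjacent. $[a,b]_{\mathbb{Z}}=\{z\in\mathbb{Z}: a\le z\le b\}$, with $c_1$-adjacency ($t,t'$ adjacent iff $|t-t'|=1$). Homotopy: for continuous $f,g:(X,\kappa)\to(Y,\lambda)$, a homotopy from $f$ to $g$ is a function $F:X\times[0,m]_{\mathbb{Z}}\to Y$, for some positive integer $m$, such that $F(x,0)=f(x)$ and $F(x,m)=g(x)$ for all $x$; for each $x\in X$, $t\mapsto F(x,t)$ is $(c_1,\lambda)$-continuous;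 and for each $t$, $x\mapsto F(x,t)$ is $(\kappa,\lambda)$-continuous. $F$ is pointed if for some $x\in X$ (held fixed) $F(x,t)=F(x,0)$ for all $t$. $NP_v(\kappa_1,\dots,\kappa_v)$-adjacency on $\prod_{i=1}^v X_i$: two distinct points $(x_1,\dots,x_v)$ and $(x_1',\dots,x_v')$ are adjacent iff for every $i$, $x_i$ and $x_i'$ are equal or $\kappa_i$-adjacent. The product map is $(\prod f_i)(x_1,\dots,x_v)=(f_1(x_1),\dots,f_v(x_v))$. *)

theory Defs
  imports "HOL-Library.FuncSet"
begin

text \<open>
  Points of the lattice of dimension \<open>n\<close> are integer lists of length \<open>n\<close>, so that
  a family of digital images may live in lattices of varying dimension. Functions between
  images are only constrained on the carrier of their domain.
\<close>

definition lattice_points :: "nat \<Rightarrow> int list set" where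
  "lattice_points n = {x. length x = n}"

definition adjacency_on :: "'a set \<Rightarrow> 'a rel \<Rightarrow> bool" where
  "adjacency_on X \<kappa> \<longleftrightarrow> \<kappa> \<subseteq> X \<times> X \<and> sym \<kappa> \<and> irrefl \<kappa>"

definition digital_image :: "int list set \<Rightarrow> int list rel \<Rightarrow> bool" where
  "digital_image X \<kappa> \<longleftrightarrow> (\<exists>n. X \<subseteq> lattice_points n) \<and> adjacency_on X \<kappa>"

definition digitally_continuous ::
    "'a set \<Rightarrow> 'a rel \<Rightarrow> 'b set \<Rightarrow> 'b rel \<Rightarrow> ('a \<Rightarrow> 'b) \<Rightarrow> bool" where
  "digitally_continuous X \<kappa> Y \<mu> f \<longleftrightarrow>
     f \<in> X \<rightarrow> Y \<and>
     (\<forall>x\<in>X. \<forall>x'\<in>X. (x, x') \<in> \<kappa> \<longrightarrow> f x = f x' \<or> (f x, f x') \<in> \<mu>)"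

definition c1_interval :: "int \<Rightarrow> int \<Rightarrow> int rel" where
  "c1_interval a b = {(s, t). s \<in> {a..b} \<and> t \<in> {a..b} \<and> \<bar>s - t\<bar> = 1}"

definition digital_homotopy ::
    "'a set \<Rightarrow> 'a rel \<Rightarrow> 'b set \<Rightarrow> 'b rel \<Rightarrow> ('a \<Rightarrow> 'b) \<Rightarrow> ('a \<Rightarrow> 'b) \<Rightarrow> int \<Rightarrow>
     ('a \<times> int \<Rightarrow> 'b) \<Rightarrow> bool" where
  "digital_homotopy X \<kappa> Y \<mu> f g m F \<longleftrightarrow>
     digitally_continuous X \<kappa> Y \<mu> f \<and>
     digitally_continuous X \<kappa> Y \<mu> g \<and>
     0 < m \<and>
     F \<in> X \<times> {0..m} \<rightarrow> Y \<and>
     (\<forall>x\<in>X. F (x, 0) = f x \<and> F (x, m) = g x) \<and>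
     (\<forall>x\<in>X. digitally_continuous {0..m} (c1_interval 0 m) Y \<mu> (\<lambda>t. F (x, t))) \<and>
     (\<forall>t\<in>{0..m}. digitally_continuous X \<kappa> Y \<mu> (\<lambda>x. F (x, t)))"

definition pointed_homotopy :: "'a set \<Rightarrow> int \<Rightarrow> ('a \<times> int \<Rightarrow> 'b) \<Rightarrow> bool" where
  "pointed_homotopy X m F \<longleftrightarrow> (\<exists>x\<in>X. \<forall>t\<in>{0..m}. F (x, t) = F (x, 0))"

text \<open>
  A tuple \<open>(x\<^sub>1, \<dots>, x\<^sub>v)\<close> is an extensional function on \<open>{1..v}\<close>; listing its coordinates
  consecutively identifies it with a lattice point, see \<open>digital_image_flattened_product\<close>.
\<close>

definition product_points :: "nat \<Rightarrow> (nat \<Rightarrow> 'a set) \<Rightarrow> (nat \<Rightarrow> 'a) set" where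
  "product_points v X = (\<Pi>\<^sub>E i\<in>{1..v}. X i)"

definition NP :: "nat \<Rightarrow> (nat \<Rightarrow> 'a set) \<Rightarrow> (nat \<Rightarrow> 'a rel) \<Rightarrow> (nat \<Rightarrow> 'a) rel" where
  "NP v X \<kappa> =
     {(x, x'). x \<in> product_points v X \<and> x' \<in> product_points v X \<and> x \<noteq> x' \<and>
               (\<forall>i\<in>{1..v}. x i = x' i \<or> (x i, x' i) \<in> \<kappa> i)}"

definition product_map :: "nat \<Rightarrow> (nat \<Rightarrow> 'a \<Rightarrow> 'b) \<Rightarrow> (nat \<Rightarrow> 'a) \<Rightarrow> (nat \<Rightarrow> 'b)" where
  "product_map v f x = (\<lambda>i\<in>{1..v}. f i (x i))"

lemma adjacency_on_NP:
  assumes "\<And>i. i \<in> {1..v} \<Longrightarrow> adjacency_on (X i) (\<kappa> i)"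
  shows "adjacency_on (product_points v X) (NP v X \<kappa>)"
  using assms unfolding adjacency_on_def NP_def
  by (auto simp: irrefl_def intro!: symI dest: symD) (metis atLeastAtMost_iff One_nat_def symD)

definition flatten :: "nat \<Rightarrow> (nat \<Rightarrow> 'a list) \<Rightarrow> 'a list" where
  "flatten v x = concat (map x [1..<Suc v])"

lemma flatten_eq_imp:
  assumes "\<And>i. i \<in> {1..v} \<Longrightarrow> length (x i) = length (y i)" and "flatten v x = flatten v y"
    and "i \<in> {1..v}"
  shows "x i = y i"
  using assms
proof (induction v)
  case (Suc v)
  have "length (flatten v x) = length (flatten v y)"
    using Suc.prems(1)
    by (auto simp: flatten_def length_concat intro!: arg_cong[of _ _ sum_list])
  moreover have "flatten v x @ x (Suc v) = flatten v y @ y (Suc v)"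
    using Suc.prems(2) by (simp add: flatten_def)
  ultimately have "flatten v x = flatten v y" "x (Suc v) = y (Suc v)"
    by auto
  with Suc show ?case
    by (cases "i = Suc v") auto
qed simp

lemma digital_image_flattened_product:
  assumes "\<And>i. i \<in> {1..v} \<Longrightarrow> digital_image (X i) (\<kappa> i)"
  shows "inj_on (flatten v) (product_points v X)"
    and "digital_image (flatten v ` product_points v X)
           (map_prod (flatten v) (flatten v) ` NP v X \<kappa>)"
proof -
  obtain n where n: "\<And>i. i \<in> {1..v} \<Longrightarrow> X i \<subseteq> lattice_points (n i)"
    using assms unfolding digital_image_def by metis
  have len: "length (x i) = n i" if "x \<in> product_points v X" "i \<in> {1..v}" for x i
    using that n[OF that(2)] unfolding product_points_def lattice_points_def by blast
  show inj: "inj_on (flatten v) (product_points v X)"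
  proof (rule inj_onI)
    fix x y assume *: "x \<in> product_points v X" "y \<in> product_points v X"
      "flatten v x = flatten v y"
    then have "x i = y i" if "i \<in> {1..v}" for i
      using flatten_eq_imp[of v x y i] len that by auto
    with * show "x = y"
      unfolding product_points_def by (blast intro: PiE_ext)
  qed
  have "length (flatten v x) = sum_list (map n [1..<Suc v])" if "x \<in> product_points v X" for x
    unfolding flatten_def length_concat using len[OF that]
    by (auto intro!: arg_cong[of _ _ sum_list])
  then have dim: "flatten v ` product_points v X
      \<subseteq> lattice_points (sum_list (map n [1..<Suc v]))"
    by (auto simp: lattice_points_def)
  have adj: "adjacency_on (product_points v X) (NP v X \<kappa>)"
    using assms by (intro adjacency_on_NP) (auto simp: digital_image_def)
  then have "adjacency_on (flatten v ` product_points v X)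
      (map_prod (flatten v) (flatten v) ` NP v X \<kappa>)"
    using inj unfolding adjacency_on_def
    by (auto simp: irrefl_def intro!: symI dest!: inj_onD dest: symD)
  with dim show "digital_image (flatten v ` product_points v X)
      (map_prod (flatten v) (flatten v) ` NP v X \<kappa>)"
    unfolding digital_image_def by blast
qed

end

theory Submission
  imports Defs
begin

text \<open>\<open>NP\<close> asks each coordinate only to be equal or adjacent, just as continuity
  does, so it behaves like a categorical product: a map into it is continuous once its coordinates
  are (\<open>digitally_continuous_tuple\<close>), and a continuous map of one coordinate stays
  continuous on the product (\<open>digitally_continuous_coordinate\<close>). Both the time and the
  space condition on a homotopy of products thus reduce to one factor. The differing lengths
  \<open>m i\<close> are reconciled by replacing time \<open>t\<close> with
  \<open>min t (m i)\<close>, which preserves continuity in time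
  (\<open>digitally_continuous_min\<close>). A tuple of base points is then fixed
  throughout.\<close>

text \<open>
  Run all homotopies simultaneously, each one stationary after its own final time: the normal
  product adjacency lets every coordinate move in the same step.
\<close>

lemma digitally_continuous_tuple:
  assumes "\<And>i. i \<in> {1..v} \<Longrightarrow> digitally_continuous Z \<zeta> (Y i) (\<mu> i) (h i)"
  shows "digitally_continuous Z \<zeta> (product_points v Y) (NP v Y \<mu>) (\<lambda>z. \<lambda>i\<in>{1..v}. h i z)"
proof -
  have mem: "(\<lambda>i\<in>{1..v}. h i z) \<in> product_points v Y" if "z \<in> Z" for z
    using assms that unfolding digitally_continuous_def product_points_def by fastforce
  moreover have "h i z = h i z' \<or> (h i z, h i z') \<in> \<mu> i"
    if "z \<in> Z" "z' \<in> Z" "(z, z') \<in> \<zeta>" "i \<in> {1..v}" for z z' i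
    using assms[OF that(4)] that(1-3) unfolding digitally_continuous_def by blast
  ultimately show ?thesis
    unfolding digitally_continuous_def NP_def by auto
qed

lemma digitally_continuous_coordinate:
  assumes "digitally_continuous (X i) (\<kappa> i) Y \<mu> h" and "i \<in> {1..v}"
  shows "digitally_continuous (product_points v X) (NP v X \<kappa>) Y \<mu> (\<lambda>x. h (x i))"
proof -
  have "x i \<in> X i" if "x \<in> product_points v X" for x
    using that assms(2) unfolding product_points_def by blast
  then show ?thesis
    using assms unfolding digitally_continuous_def NP_def Pi_iff by fastforce
qed

lemma digitally_continuous_product_map:
  assumes "\<And>i. i \<in> {1..v} \<Longrightarrow> digitally_continuous (X i) (\<kappa> i) (Y i) (\<mu> i) (h i)"
  shows "digitally_continuous (product_points v X) (NP v X \<kappa>)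
           (product_points v Y) (NP v Y \<mu>) (product_map v h)"
  unfolding product_map_def[abs_def]
  by (intro digitally_continuous_tuple digitally_continuous_coordinate assms)

text \<open>Truncation \<open>t \<mapsto> min t m\<close> never increases distances, so a unit step
  in time becomes a unit step or no step. Positivity of \<open>m\<close> keeps the truncated time in
  \<open>{0..m}\<close>.\<close>

lemma digitally_continuous_min:
  assumes "digitally_continuous {0..m} (c1_interval 0 m) Y \<mu> h" and "0 < m"
  shows "digitally_continuous {0..M} (c1_interval 0 M) Y \<mu> (\<lambda>t. h (min t m))"
proof -
  have mem: "min t m \<in> {0..m}" if "t \<in> {0..M}" for t
    using that assms(2) by auto
  have "min s m = min t m \<or> (min s m, min t m) \<in> c1_interval 0 m"
    if "(s, t) \<in> c1_interval 0 M" for s t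
    using that assms(2) unfolding c1_interval_def by auto
  with mem show ?thesis
    using assms(1) unfolding digitally_continuous_def Pi_iff by metis
qed

definition product_homotopy ::
    "nat \<Rightarrow> (nat \<Rightarrow> int) \<Rightarrow> (nat \<Rightarrow> 'a \<times> int \<Rightarrow> 'b) \<Rightarrow> (nat \<Rightarrow> 'a) \<times> int \<Rightarrow> nat \<Rightarrow> 'b" where
  "product_homotopy v m H = (\<lambda>(x, t). \<lambda>i\<in>{1..v}. H i (x i, min t (m i)))"

lemma digital_homotopy_product:
  assumes hom: "\<And>i. i \<in> {1..v} \<Longrightarrow>
      digital_homotopy (X i) (\<kappa> i) (Y i) (\<mu> i) (f i) (g i) (m i) (H i)"
    and M: "0 < M" "\<And>i. i \<in> {1..v} \<Longrightarrow> m i \<le> M"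
  shows "digital_homotopy (product_points v X) (NP v X \<kappa>) (product_points v Y) (NP v Y \<mu>)
           (product_map v f) (product_map v g) M (product_homotopy v m H)"
proof -
  have pos: "0 < m i" if "i \<in> {1..v}" for i
    using hom[OF that] unfolding digital_homotopy_def by blast
  have coord: "x i \<in> X i" if "x \<in> product_points v X" "i \<in> {1..v}" for x i
    using that unfolding product_points_def by blast
  \<comment> \<open>The bounds \<open>0 < m i\<close> and \<open>m i \<le> M\<close> make every
    truncated clock start at 0 and reach its own end by time \<open>M\<close>.\<close>
  have "min 0 (m i) = 0" "min M (m i) = m i" if "i \<in> {1..v}" for i
    using pos[OF that] M(2)[OF that] by simp_all
  then have ends: "H i (x i, min 0 (m i)) = f i (x i)" "H i (x i, min M (m i)) = g i (x i)"
    if "x \<in> product_points v X" "i \<in> {1..v}" for x i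
    using hom[OF that(2)] coord[OF that] that(2) unfolding digital_homotopy_def by simp_all
  have "product_homotopy v m H (x, 0) = product_map v f x"
    "product_homotopy v m H (x, M) = product_map v g x" if "x \<in> product_points v X" for x
    unfolding product_homotopy_def product_map_def prod.case
    by (intro restrict_ext ends that; assumption)+
  moreover have time: "digitally_continuous {0..M} (c1_interval 0 M)
      (product_points v Y) (NP v Y \<mu>) (\<lambda>t. product_homotopy v m H (x, t))"
    if x: "x \<in> product_points v X" for x
    unfolding product_homotopy_def prod.case
  proof (rule digitally_continuous_tuple)
    fix i assume i: "i \<in> {1..v}"
    show "digitally_continuous {0..M} (c1_interval 0 M) (Y i) (\<mu> i)
        (\<lambda>t. H i (x i, min t (m i)))"
      using hom[OF i] coord[OF x i] unfolding digital_homotopy_def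
      by (intro digitally_continuous_min[where h = "\<lambda>s. H i (x i, s)"]) blast+
  qed
  moreover have "digitally_continuous (product_points v X) (NP v X \<kappa>)
      (product_points v Y) (NP v Y \<mu>) (\<lambda>x. product_homotopy v m H (x, t))"
    if t: "t \<in> {0..M}" for t
    unfolding product_homotopy_def prod.case
  proof (rule digitally_continuous_tuple)
    fix i assume i: "i \<in> {1..v}"
    have "min t (m i) \<in> {0..m i}"
      using t pos[OF i] by auto
    then show "digitally_continuous (product_points v X) (NP v X \<kappa>) (Y i) (\<mu> i)
        (\<lambda>x. H i (x i, min t (m i)))"
      using hom[OF i] i unfolding digital_homotopy_def
      by (intro digitally_continuous_coordinate[where h = "\<lambda>y. H i (y, min t (m i))"]) blast+
  qed
  \<comment> \<open>\<open>digitally_continuous\<close> includes landing in the codomain, so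
    continuity in time already yields this.\<close>
  moreover have "product_homotopy v m H \<in> product_points v X \<times> {0..M} \<rightarrow> product_points v Y"
    using time unfolding digitally_continuous_def by auto
  moreover have "digitally_continuous (product_points v X) (NP v X \<kappa>)
      (product_points v Y) (NP v Y \<mu>) (product_map v f)"
    "digitally_continuous (product_points v X) (NP v X \<kappa>)
      (product_points v Y) (NP v Y \<mu>) (product_map v g)"
    by (intro digitally_continuous_product_map; use hom digital_homotopy_def in blast)+
  ultimately show ?thesis
    using M(1) unfolding digital_homotopy_def by blast
qed

text \<open>Choose a stationary point \<open>p i\<close> for each factor; their tuple is stationary,
  since truncated times still lie in \<open>{0..m i}\<close>. This works for any final time
  \<open>M\<close>.\<close>

lemma pointed_homotopy_product:
  assumes "\<And>i. i \<in> {1..v} \<Longrightarrow> pointed_homotopy (X i) (m i) (H i)"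
    and pos: "\<And>i. i \<in> {1..v} \<Longrightarrow> 0 < m i"
  shows "pointed_homotopy (product_points v X) M (product_homotopy v m H)"
proof -
  have "\<forall>i\<in>{1..v}. \<exists>x. x \<in> X i \<and> (\<forall>t\<in>{0..m i}. H i (x, t) = H i (x, 0))"
    using assms(1) unfolding pointed_homotopy_def by blast
  from bchoice[OF this] obtain p where p: "\<And>i. i \<in> {1..v} \<Longrightarrow> p i \<in> X i"
    "\<And>i t. i \<in> {1..v} \<Longrightarrow> t \<in> {0..m i} \<Longrightarrow> H i (p i, t) = H i (p i, 0)"
    by blast
  have "H i (p i, min t (m i)) = H i (p i, min 0 (m i))" if "i \<in> {1..v}" "t \<in> {0..M}" for i t
    using p(2)[OF that(1), of "min t (m i)"] pos[OF that(1)] that(2) by (simp add: min_def)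
  then have "\<forall>t\<in>{0..M}. product_homotopy v m H (restrict p {1..v}, t) =
      product_homotopy v m H (restrict p {1..v}, 0)"
    unfolding product_homotopy_def prod.case by (intro ballI restrict_ext) (simp only: restrict_apply')
  \<comment> \<open>Points of the product are extensional, so the choice function is cut down to
    \<open>{1..v}\<close>.\<close>
  moreover have "restrict p {1..v} \<in> product_points v X"
    using p(1) unfolding product_points_def by simp
  ultimately show ?thesis
    unfolding pointed_homotopy_def by blast
qed

theorem theorem6p1:
  fixes v :: nat
    and X Y :: "nat \<Rightarrow> int list set"
    and \<kappa> \<mu> :: "nat \<Rightarrow> int list rel"
    and f g :: "nat \<Rightarrow> int list \<Rightarrow> int list"
    and m :: "nat \<Rightarrow> int"
    and H :: "nat \<Rightarrow> int list \<times> int \<Rightarrow> int list"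
  assumes "v > 0"
    and "\<And>i. i \<in> {1..v} \<Longrightarrow> digital_image (X i) (\<kappa> i)"
    and "\<And>i. i \<in> {1..v} \<Longrightarrow> digital_image (Y i) (\<mu> i)"
    and "\<And>i. i \<in> {1..v} \<Longrightarrow> digitally_continuous (X i) (\<kappa> i) (Y i) (\<mu> i) (f i)"
    and "\<And>i. i \<in> {1..v} \<Longrightarrow> digitally_continuous (X i) (\<kappa> i) (Y i) (\<mu> i) (g i)"
    and "\<And>i. i \<in> {1..v} \<Longrightarrow>
           digital_homotopy (X i) (\<kappa> i) (Y i) (\<mu> i) (f i) (g i) (m i) (H i)"
  shows "(\<exists>M K. digital_homotopy (product_points v X) (NP v X \<kappa>) (product_points v Y) (NP v Y \<mu>)
                  (product_map v f) (product_map v g) M K) \<and>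
         ((\<forall>i\<in>{1..v}. pointed_homotopy (X i) (m i) (H i)) \<longrightarrow>
            (\<exists>M K. digital_homotopy (product_points v X) (NP v X \<kappa>)
                     (product_points v Y) (NP v Y \<mu>)
                     (product_map v f) (product_map v g) M K \<and>
                   pointed_homotopy (product_points v X) M K))"
proof -
  \<comment> \<open>The common duration is that of the longest homotopy; one witness,
    \<open>product_homotopy v m H\<close>, serves both claims.\<close>
  define M where "M = Max (m ` {1..v})"
  have pos: "0 < m i" if "i \<in> {1..v}" for i
    using assms(6)[OF that] unfolding digital_homotopy_def by blast
  have le: "m i \<le> M" if "i \<in> {1..v}" for i
    using that unfolding M_def by simp
  \<comment> \<open>As \<open>v > 0\<close>, index 1 exists, and \<open>M\<close> is at least the
    positive \<open>m 1\<close>.\<close>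
  have "0 < M"
    using pos[of 1] le[of 1] assms(1) by simp
  then show ?thesis
    using digital_homotopy_product[of v X \<kappa> Y \<mu> f g m H M, OF assms(6) _ le]
      pointed_homotopy_product[of v X m H M, OF _ pos]
    by blast
qed

end
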